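(* Let $a>b>0$, $c=\sqrt{a^2-b^2}$, and let $\beta(t)=(a\cos t,\,b\sin t)$, $t\in\mathbb{R}$, be the ellipse with foci $F=(c,0)$ and $F'=(-c,0)$. Fix $t_0\in\mathbb{R}$. (1) The roulette of $F$ as $\beta$ rolls on a straight line, with arc length measured from $t_0$, is $B_1(t)=(g_u^1(t),f_u^1(t))$ with $$g_u^1(t)=\int_{t_0}^t\sqrt{a^2-c^2\cos^2 z}\,dz-\frac{c\sin t\,(a-c\cos t)}{\sqrt{a^2-c^2\cos^2 t}},\qquad f_u^1(t)=\frac{b(a-c\cos t)}{\sqrt{a^2-c^2\cos^2 t}}.$$ Moreover $|B_1'(t)|=\dfrac{ab}{a+c\cos t}$, and for $t_0,t\in(-\pi,\pi)$ $$\int_{t_0}^t|B_1'(z)|\,dz=\left.2a\arctan\left(\sqrt{\tfrac{a-c}{a+c}}\tan\tfrac z2\right)\right|_{z=t_0}^{z=t}.$$ (2) The roulette of $F'$, with arc length measured from $t_0$, is $B_2(t)=(g_u^2(t),f_u^2(t))$ with $$g_u^2(t)=\int_{t_0}^t\sqrt{a^2-c^2\cos^2 z}\,dz+\frac{c\sin t\,(a+c\cos t)}{\sqrt{a^2-c^2\cos^2 t}},\qquad f_u^2(t)=\frac{b(a+c\cos t)}{\sqrt{a^2-c^2\cos^2 t}}.$$ Moreover $|B_2'(t)|=\dfrac{ab}{a-c\cos t}$, and for $t_0,t\in(-\pi,\pi)$ $$\int_{t_0}^t|B_2'(z)|\,dz=\left.2a\arctan\left(\sqrt{\tfrac{a+c}{a-c}}\tan\tfrac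 z2\right)\right|_{z=t_0}^{z=t}.$$ (3) The sum of the lengths of $B_1$ and $B_2$ restricted to $t\in(-\tfrac{\pi}{2},\tfrac{\pi}{2})$ is $2\pi a$.
   Context: Roulette of a point under rolling on a straight line: let $P(t)$ be a regular smooth plane curve with unit tangent $T(t)=P'(t)/|P'(t)|$, let $\Phi$ be a fixed point of the plane of the curve (here a focus), and let $s(t)=\int_{t_0}^t|P'(z)|\,dz$ be the signed arc length from $t_0$. Let $Q(t)$ be the orthogonal projection of $\Phi$ onto the tangent line to the curve at $P(t)$. When the curve rolls without slipping on a straight line (taken as the abscissa axis), the roulette of $\Phi$ is the curve with abscissa $s(t)-\langle P(t)-Q(t),T(t)\rangle$ and ordinate the distance $|\Phi-Q(t)|$. *)

theory Defs
  imports "HOL-Analysis.Analysis"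
begin

definition ellipse :: "real \<Rightarrow> real \<Rightarrow> real \<Rightarrow> real \<times> real" where
  "ellipse a b t = (a * cos t, b * sin t)"

definition speed :: "(real \<Rightarrow> real \<times> real) \<Rightarrow> real \<Rightarrow> real" where
  "speed P t = norm (vector_derivative P (at t))"

definition unit_tangent :: "(real \<Rightarrow> real \<times> real) \<Rightarrow> real \<Rightarrow> real \<times> real" where
  "unit_tangent P t = vector_derivative P (at t) /\<^sub>R speed P t"

(* Signed: the interval integral changes sign when t < t0. *)
definition arc_length :: "(real \<Rightarrow> real \<times> real) \<Rightarrow> real \<Rightarrow> real \<Rightarrow> real" where
  "arc_length P t0 t = (LBINT z=ereal t0..ereal t. speed P z)"

definition tangent_line :: "(real \<Rightarrow> real \<times> real) \<Rightarrow> real \<Rightarrow> (real \<times> real) set" where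
  "tangent_line P t = {P t + r *\<^sub>R unit_tangent P t | r. True}"

definition orth_proj :: "(real \<times> real) set \<Rightarrow> real \<times> real \<Rightarrow> real \<times> real" where
  "orth_proj L x = (THE q. q \<in> L \<and> (\<forall>y\<in>L. orthogonal (x - q) (y - q)))"

definition pedal_point :: "(real \<Rightarrow> real \<times> real) \<Rightarrow> real \<times> real \<Rightarrow> real \<Rightarrow> real \<times> real" where
  "pedal_point P \<Phi> t = orth_proj (tangent_line P t) \<Phi>"

(* P (a regular smooth curve) rolls without slipping on the abscissa axis: at parameter t the
   point P t is in contact with the axis at abscissa arc_length P t0 t, and its tangent line lies
   along the axis, so the pedal point of \<Phi> is the foot of the perpendicular from \<Phi> to the axis. *)
definition roulette ::
  "(real \<Rightarrow> real \<times> real) \<Rightarrow> real \<times> real \<Rightarrow> real \<Rightarrow> real \<Rightarrow> real \<times> real" where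
  "roulette P \<Phi> t0 t =
     (arc_length P t0 t - inner (P t - pedal_point P \<Phi> t) (unit_tangent P t),
      dist \<Phi> (pedal_point P \<Phi> t))"

end

theory Submission
  imports Defs
begin

text \<open>The two foci are treated together as the point \<open>(d, 0)\<close> with \<open>d\<^sup>2 = a\<^sup>2 - b\<^sup>2\<close>, so that
  \<open>d = c\<close> and \<open>d = - c\<close>. During the rolling the focus turns instantaneously about the point of
  contact, from which it has distance \<open>a - d cos t\<close>; the tangent turns at the rate
  \<open>a b / (a\<^sup>2 - d\<^sup>2 cos\<^sup>2 t)\<close>. Hence the roulette has speed \<open>a b / (a + d cos t)\<close>, which the
  half-angle substitution integrates. The two arcs in the last claim have lengths
  \<open>4 a arctan k\<close> and \<open>4 a arctan (1 / k)\<close>.\<close>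

section \<open>Orthogonal projection on a line and the roulette in terms of the unit tangent\<close>

lemma orth_proj_line:
  fixes p v x :: "real \<times> real"
  assumes "norm v = 1"
  shows "orth_proj {p + r *\<^sub>R v | r. True} x = p + inner (x - p) v *\<^sub>R v"
  unfolding orth_proj_def
proof (rule the_equality)
  have vv: "inner v v = 1"
    using assms by (simp add: norm_eq_1)
  have "p + inner (x - p) v *\<^sub>R v \<in> {p + r *\<^sub>R v | r. True}"
    by blast
  moreover have "(\<forall>y\<in>{p + r *\<^sub>R v | r. True}.
       orthogonal (x - (p + inner (x - p) v *\<^sub>R v)) (y - (p + inner (x - p) v *\<^sub>R v)))"
    using vv by (auto simp: orthogonal_def inner_diff inner_add algebra_simps)
  ultimately show "p + inner (x - p) v *\<^sub>R v \<in> {p + r *\<^sub>R v | r. True} \<and>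
    (\<forall>y\<in>{p + r *\<^sub>R v | r. True}.
       orthogonal (x - (p + inner (x - p) v *\<^sub>R v)) (y - (p + inner (x - p) v *\<^sub>R v)))"
    by blast
  fix q
  assume q: "q \<in> {p + r *\<^sub>R v | r. True} \<and>
    (\<forall>y\<in>{p + r *\<^sub>R v | r. True}. orthogonal (x - q) (y - q))"
  then obtain r where r: "q = p + r *\<^sub>R v"
    by auto
  \<comment> \<open>For uniqueness, the point one unit beyond \<open>q\<close> on the line is
    tested: its difference from \<open>q\<close> is \<open>v\<close> itself.\<close>
  have "p + (r + 1) *\<^sub>R v \<in> {p + r *\<^sub>R v | r. True}"
    by auto
  then have "orthogonal (x - q) (p + (r + 1) *\<^sub>R v - q)"
    using q by blast
  then have "inner (x - q) v = 0"
    by (simp add: r orthogonal_def algebra_simps)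
  then have "inner (x - p) v = r"
    using vv by (simp add: r inner_diff inner_add algebra_simps)
  then show "q = p + inner (x - p) v *\<^sub>R v"
    by (simp add: r)
qed

text \<open>Splits \<open>\<Phi> - P t\<close> into tangential and normal parts: the foot of the
  perpendicular differs from \<open>P t\<close> by the tangential part, so minus the product in the
  abscissa turns into plus, and the ordinate is the length of the normal part.\<close>

lemma roulette_eq:
  assumes "norm (unit_tangent P t) = 1"
  shows "roulette P \<Phi> t0 t =
    (arc_length P t0 t + inner (\<Phi> - P t) (unit_tangent P t),
     norm (\<Phi> - P t - inner (\<Phi> - P t) (unit_tangent P t) *\<^sub>R unit_tangent P t))"
proof -
  have "pedal_point P \<Phi> t = P t + inner (\<Phi> - P t) (unit_tangent P t) *\<^sub>R unit_tangent P t"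
    unfolding pedal_point_def tangent_line_def using assms by (rule orth_proj_line)
  moreover have "inner (unit_tangent P t) (unit_tangent P t) = 1"
    using assms by (simp add: norm_eq_1)
  ultimately show ?thesis
    by (simp add: roulette_def dist_norm diff_diff_eq)
qed

lemma has_real_derivative_interval_integral:
  fixes f :: "real \<Rightarrow> real"
  assumes "continuous_on UNIV f"
  shows "((\<lambda>t. LBINT z=ereal t0..ereal t. f z) has_real_derivative f t) (at t)"
proof -
  \<comment> \<open>The fundamental theorem gives a derivative within a compact interval. The margin
    of 1 makes \<open>t\<close> interior, so that the derivative is two-sided.\<close>
  let ?l = "min t0 t - 1" and ?u = "max t0 t + 1"
  have "((\<lambda>t. LBINT z=ereal t0..ereal t. f z) has_vector_derivative f t) (at t within {?l..?u})"
    by (rule interval_integral_FTC2) (auto intro: continuous_on_subset[OF assms])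
  moreover have "at t within {?l..?u} = at t"
    by (rule at_within_Icc_at) auto
  ultimately show ?thesis
    by (simp add: has_real_derivative_iff_has_vector_derivative)
qed

section \<open>Speed and focal distances of the ellipse\<close>

lemma vector_derivative_ellipse:
  "vector_derivative (ellipse a b) (at t) = (- a * sin t, b * cos t)"
proof -
  have "(ellipse a b has_vector_derivative (- a * sin t, b * cos t)) (at t)"
    unfolding ellipse_def
    by (rule has_vector_derivative_Pair)
       (auto intro!: derivative_eq_intros simp flip: has_real_derivative_iff_has_vector_derivative)
  then show ?thesis
    by (rule vector_derivative_at)
qed

lemma abs_focus_less:
  fixes a b d :: real
  assumes "0 < a" "0 < b" "d\<^sup>2 = a\<^sup>2 - b\<^sup>2"
  shows "\<bar>d\<bar> < a"
proof (rule power2_less_imp_less)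
  have "0 < b\<^sup>2"
    using assms by simp
  then show "\<bar>d\<bar>\<^sup>2 < a\<^sup>2"
    using assms by simp
qed (use assms in simp)

text \<open>When \<open>d\<^sup>2 = a\<^sup>2 - b\<^sup>2\<close>, the quantities
  \<open>a - d * cos x\<close> and \<open>a + d * cos x\<close> are the distances of
  \<open>ellipse a b x\<close> from \<open>(d, 0)\<close> and \<open>(- d, 0)\<close>; they occur as
  denominators below.\<close>

lemma focal_radius_pos:
  fixes a d x :: real
  assumes "\<bar>d\<bar> < a"
  shows "0 < a + d * cos x" "0 < a - d * cos x"
proof -
  have "\<bar>d * cos x\<bar> \<le> \<bar>d\<bar>"
    by (simp add: abs_mult mult_left_le)
  with assms show "0 < a + d * cos x" "0 < a - d * cos x"
    by linarith+
qed

text \<open>The squared speed of the ellipse is thus the product of the two focal distances; this is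
  what later cancels one of them from the speed of the roulette.\<close>

lemma radicand_factor:
  fixes a d x :: real
  shows "a\<^sup>2 - d\<^sup>2 * (cos x)\<^sup>2 = (a - d * cos x) * (a + d * cos x)"
  by (simp add: algebra_simps power2_eq_square)

lemma radicand_pos:
  fixes a d x :: real
  assumes "\<bar>d\<bar> < a"
  shows "0 < a\<^sup>2 - d\<^sup>2 * (cos x)\<^sup>2"
  using focal_radius_pos[OF assms, of x] by (simp add: radicand_factor)

lemma speed_ellipse:
  assumes "d\<^sup>2 = a\<^sup>2 - b\<^sup>2"
  shows "speed (ellipse a b) t = sqrt (a\<^sup>2 - d\<^sup>2 * (cos t)\<^sup>2)"
proof -
  have "(a * sin t)\<^sup>2 + (b * cos t)\<^sup>2 = a\<^sup>2 - d\<^sup>2 * (cos t)\<^sup>2"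
    by (simp add: assms power_mult_distrib sin_squared_eq algebra_simps)
  then show ?thesis
    by (simp add: speed_def vector_derivative_ellipse norm_Pair)
qed

section \<open>Coordinates, velocity and speed of the roulette of a focus\<close>

lemma roulette_ellipse_focus:
  fixes a b d t :: real
  assumes "0 < a" "0 < b" and d: "d\<^sup>2 = a\<^sup>2 - b\<^sup>2"
  shows "roulette (ellipse a b) (d, 0) t0 t =
    ((LBINT z=ereal t0..ereal t. sqrt (a\<^sup>2 - d\<^sup>2 * (cos z)\<^sup>2))
       - d * sin t * (a - d * cos t) / sqrt (a\<^sup>2 - d\<^sup>2 * (cos t)\<^sup>2),
     b * (a - d * cos t) / sqrt (a\<^sup>2 - d\<^sup>2 * (cos t)\<^sup>2))"
proof -
  \<comment> \<open>\<open>w\<close> is the speed of the ellipse and \<open>u\<close> the distance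
    from the point of contact to the focus.\<close>
  define w where "w = sqrt (a\<^sup>2 - d\<^sup>2 * (cos t)\<^sup>2)"
  define u where "u = a - d * cos t"
  have da: "\<bar>d\<bar> < a"
    using abs_focus_less assms by blast
  have w: "w > 0" and u: "u > 0"
    using radicand_pos[OF da] focal_radius_pos[OF da] by (auto simp: w_def u_def)
  have w2: "w\<^sup>2 = a\<^sup>2 * (sin t)\<^sup>2 + b\<^sup>2 * (cos t)\<^sup>2"
    using radicand_pos[OF da, of t] by (simp add: w_def d sin_squared_eq algebra_simps)
  have wuv: "w\<^sup>2 = u * (a + d * cos t)"
    using radicand_pos[OF da, of t] by (simp add: w_def u_def flip: radicand_factor)
  have T: "unit_tangent (ellipse a b) t = (- a * sin t / w, b * cos t / w)"
    by (simp add: unit_tangent_def vector_derivative_ellipse speed_ellipse[OF d] w_def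
        divide_inverse_commute)
  have "(a * sin t / w)\<^sup>2 + (b * cos t / w)\<^sup>2 = (a\<^sup>2 * (sin t)\<^sup>2 + b\<^sup>2 * (cos t)\<^sup>2) / w\<^sup>2"
    by (simp add: power_divide power_mult_distrib add_divide_distrib)
  also have "\<dots> = 1"
    using w by (simp flip: w2)
  finally have nT: "norm (unit_tangent (ellipse a b) t) = 1"
    by (simp add: T norm_Pair power_divide)
  define m where "m = - (d * sin t * u / w)"
  have m: "inner ((d, 0) - ellipse a b t) (unit_tangent (ellipse a b) t) = m"
  proof -
    have "- ((d - a * cos t) * (a * sin t)) - b * sin t * (b * cos t)
        = sin t * ((a\<^sup>2 - b\<^sup>2) * cos t - d * a)"
      by (simp add: algebra_simps power2_eq_square)
    also have "\<dots> = - (d * sin t * u)"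
      unfolding d[symmetric] by (simp add: u_def algebra_simps power2_eq_square)
    finally show ?thesis
      using w by (simp add: T ellipse_def m_def divide_simps)
  qed
  \<comment> \<open>\<open>n\<close> is the claimed ordinate. Instead of expanding a norm,
    \<open>p1\<close> and \<open>p2\<close> show coordinatewise that the normal part is
    \<open>- n\<close> times the unit normal \<open>(b * cos t / w, a * sin t / w)\<close>.\<close>
  define n where "n = b * u / w"
  have n: "0 \<le> n"
    using w u assms by (simp add: n_def)
  have p1: "d - a * cos t + m * (a * sin t / w) = - (n * (b * cos t / w))"
  proof -
    \<comment> \<open>This is \<open>p1\<close> with denominators cleared. Eliminating
      \<open>b\<^sup>2\<close> and the squared sine leaves a polynomial identity in
      \<open>a\<close>, \<open>d\<close> and \<open>cos t\<close>.\<close>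
    have "(d - a * cos t) * w\<^sup>2 = d * sin t * u * (a * sin t) - b * u * (b * cos t)"
    proof -
      have "d * sin t * u * (a * sin t) - b * u * (b * cos t)
          = u * (a * d * (sin t)\<^sup>2 - b\<^sup>2 * cos t)"
        by (simp add: algebra_simps power2_eq_square)
      also have "b\<^sup>2 = a\<^sup>2 - d\<^sup>2"
        using d by simp
      also have "u * (a * d * (sin t)\<^sup>2 - (a\<^sup>2 - d\<^sup>2) * cos t) = (d - a * cos t) * (u * (a + d * cos t))"
        unfolding sin_squared_eq by algebra
      finally show ?thesis
        by (simp add: wuv)
    qed
    then have "d - a * cos t = (d * sin t * u * (a * sin t) - b * u * (b * cos t)) / w\<^sup>2"
      using w by (simp add: eq_divide_eq)
    then show ?thesis
      by (simp add: m_def n_def diff_divide_distrib power2_eq_square)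
  qed
  have p2: "- (b * sin t) - m * (b * cos t / w) = - (n * (a * sin t / w))"
  proof -
    have "b * sin t * w\<^sup>2 = d * sin t * u * (b * cos t) + b * u * (a * sin t)"
      by (simp add: wuv algebra_simps)
    then have "b * sin t = (d * sin t * u * (b * cos t) + b * u * (a * sin t)) / w\<^sup>2"
      using w by (simp add: eq_divide_eq)
    then show ?thesis
      by (simp add: m_def n_def add_divide_distrib power2_eq_square)
  qed
  have "norm ((d, 0) - ellipse a b t - m *\<^sub>R unit_tangent (ellipse a b) t)
      = norm ((- n) *\<^sub>R (b * cos t / w, a * sin t / w))"
    using p1 p2 by (simp add: T ellipse_def)
  also have "\<dots> = n * norm (b * cos t / w, a * sin t / w)"
    using n by (simp only: norm_scaleR) simp
  also have "norm (b * cos t / w, a * sin t / w) = norm (unit_tangent (ellipse a b) t)"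
    by (simp add: T norm_Pair add.commute)
  finally have "norm ((d, 0) - ellipse a b t - m *\<^sub>R unit_tangent (ellipse a b) t) = n"
    by (simp add: nT)
  then show ?thesis
    unfolding roulette_eq[OF nT] m arc_length_def speed_ellipse[OF d]
    by (simp add: m_def n_def u_def w_def)
qed

text \<open>The vector from the point of contact to the focus is a positive multiple of
  \<open>(- d * sin t, b)\<close>, and the velocity is perpendicular to it. The factor
  \<open>k\<close> is the turning rate times the focal distance, divided by the length of
  \<open>(b, d * sin t)\<close>.\<close>

lemma has_vector_derivative_roulette_ellipse_focus:
  fixes a b d t :: real
  assumes "0 < a" "0 < b" and d: "d\<^sup>2 = a\<^sup>2 - b\<^sup>2"
  defines "k \<equiv> a * b * (a - d * cos t) / sqrt (a\<^sup>2 - d\<^sup>2 * (cos t)\<^sup>2) ^ 3"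
  shows "(roulette (ellipse a b) (d, 0) t0 has_vector_derivative k *\<^sub>R (b, d * sin t)) (at t)"
proof -
  let ?w = "\<lambda>t. sqrt (a\<^sup>2 - d\<^sup>2 * (cos t)\<^sup>2)"
  define w where "w = ?w t"
  have da: "\<bar>d\<bar> < a"
    using abs_focus_less assms by blast
  have w: "w > 0"
    using radicand_pos[OF da] by (simp add: w_def)
  have w2: "w\<^sup>2 = a\<^sup>2 - d\<^sup>2 * (cos t)\<^sup>2"
    using radicand_pos[OF da, of t] by (simp add: w_def)
  have sc: "(sin t)\<^sup>2 = 1 - (cos t)\<^sup>2" and b2: "b\<^sup>2 = a\<^sup>2 - d\<^sup>2"
    using d by (simp_all add: sin_squared_eq)
  have dw: "(?w has_real_derivative d\<^sup>2 * cos t * sin t / w) (at t)"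
    using radicand_pos[OF da, of t] by (auto intro!: derivative_eq_intros simp: w_def field_simps)
  have ds: "((\<lambda>t. LBINT z=ereal t0..ereal t. ?w z) has_real_derivative w) (at t)"
    unfolding w_def by (rule has_real_derivative_interval_integral) (intro continuous_intros)
  have w0: "?w t \<noteq> 0"
    using w by (simp add: w_def)
  have "((\<lambda>t. d * sin t * (a - d * cos t)) has_real_derivative
      d * cos t * (a - d * cos t) + d\<^sup>2 * (sin t)\<^sup>2) (at t)"
    by (auto intro!: derivative_eq_intros simp: algebra_simps power2_eq_square)
  from DERIV_diff[OF ds DERIV_divide[OF this dw w0, folded w_def]]
  have "((\<lambda>t. (LBINT z=ereal t0..ereal t. ?w z) - d * sin t * (a - d * cos t) / ?w t)
      has_real_derivative k * b) (at t)"
  proof (rule DERIV_cong)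
    \<comment> \<open>The derivative of the abscissa multiplied by \<open>w ^ 3\<close>; the
      substitutions make both sides polynomials in \<open>a\<close>, \<open>d\<close> and
      \<open>cos t\<close>.\<close>
    have "w\<^sup>2 * w\<^sup>2 - ((d * cos t * (a - d * cos t) + d\<^sup>2 * (sin t)\<^sup>2) * w\<^sup>2
        - d * (a - d * cos t) * (d\<^sup>2 * cos t * (sin t)\<^sup>2)) = a * b\<^sup>2 * (a - d * cos t)"
      unfolding w2 sc b2 by algebra
    then have "w - ((d * cos t * (a - d * cos t) + d\<^sup>2 * (sin t)\<^sup>2) * w
        - d * sin t * (a - d * cos t) * (d\<^sup>2 * cos t * sin t / w)) / (w * w)
      = a * b\<^sup>2 * (a - d * cos t) / w ^ 3"
      using w by (simp add: field_simps power2_eq_square power3_eq_cube)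
    then show "w - ((d * cos t * (a - d * cos t) + d\<^sup>2 * (sin t)\<^sup>2) * w
        - d * sin t * (a - d * cos t) * (d\<^sup>2 * cos t * sin t / w)) / (w * w) = k * b"
      by (simp add: k_def w_def power2_eq_square mult_ac)
  qed
  moreover have "((\<lambda>t. b * (a - d * cos t) / ?w t) has_real_derivative k * (d * sin t)) (at t)"
  proof -
    have "((\<lambda>t. b * (a - d * cos t)) has_real_derivative b * (d * sin t)) (at t)"
      by (auto intro!: derivative_eq_intros)
    from DERIV_divide[OF this dw w0, folded w_def] show ?thesis
    proof (rule DERIV_cong)
      \<comment> \<open>As \<open>a - d * cos t\<close> divides \<open>w\<^sup>2\<close> with
        quotient \<open>a + d * cos t\<close>, it factors out and leaves \<open>a\<close>.\<close>
      have "w\<^sup>2 - (a - d * cos t) * (d * cos t) = a * (a - d * cos t)"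
        unfolding w2 by algebra
      then have "b * d * sin t * (w\<^sup>2 - (a - d * cos t) * (d * cos t))
          = b * d * sin t * (a * (a - d * cos t))"
        by simp
      then have "(b * (d * sin t) * w - b * (a - d * cos t) * (d\<^sup>2 * cos t * sin t / w)) / (w * w)
          = a * b * (a - d * cos t) * (d * sin t) / w ^ 3"
        using w by (simp add: field_simps power2_eq_square power3_eq_cube)
      then show "(b * (d * sin t) * w - b * (a - d * cos t) * (d\<^sup>2 * cos t * sin t / w)) / (w * w)
          = k * (d * sin t)"
        by (simp add: k_def w_def)
    qed
  qed
  moreover have "roulette (ellipse a b) (d, 0) t0 =
    (\<lambda>t. ((LBINT z=ereal t0..ereal t. ?w z) - d * sin t * (a - d * cos t) / ?w t,
      b * (a - d * cos t) / ?w t))"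
    using roulette_ellipse_focus[OF assms(1-3)] by (intro ext)
  ultimately show ?thesis
    by (auto intro!: has_vector_derivative_Pair
        simp flip: has_real_derivative_iff_has_vector_derivative)
qed

lemma speed_roulette_ellipse_focus:
  fixes a b d t :: real
  assumes "0 < a" "0 < b" and d: "d\<^sup>2 = a\<^sup>2 - b\<^sup>2"
  shows "speed (roulette (ellipse a b) (d, 0) t0) t = a * b / (a + d * cos t)"
proof -
  define w where "w = sqrt (a\<^sup>2 - d\<^sup>2 * (cos t)\<^sup>2)"
  have da: "\<bar>d\<bar> < a"
    using abs_focus_less assms by blast
  note pos = focal_radius_pos[OF da, of t]
  have w: "w > 0" and w2: "w\<^sup>2 = (a - d * cos t) * (a + d * cos t)"
    using radicand_pos[OF da, of t] by (simp_all add: w_def flip: radicand_factor)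
  \<comment> \<open>The direction vector of the velocity has length \<open>w\<close> again, so one
    power of \<open>w\<close> cancels against the cube.\<close>
  have "b\<^sup>2 + (d * sin t)\<^sup>2 = a\<^sup>2 - d\<^sup>2 * (cos t)\<^sup>2"
    using d by (simp add: power_mult_distrib sin_squared_eq algebra_simps)
  then have "norm (b, d * sin t) = w"
    by (simp add: norm_Pair w_def)
  then have "speed (roulette (ellipse a b) (d, 0) t0) t = a * b * (a - d * cos t) / w ^ 3 * w"
    unfolding speed_def
      vector_derivative_at[OF has_vector_derivative_roulette_ellipse_focus[OF assms]] norm_scaleR
    using w pos assms(1,2) by (simp flip: w_def)
  also have "\<dots> = a * b * (a - d * cos t) / w\<^sup>2"
    using w by (simp add: power2_eq_square power3_eq_cube)
  also have "\<dots> = a * b / (a + d * cos t)"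
    unfolding w2 using pos by simp
  finally show ?thesis .
qed

section \<open>Half-angle antiderivative and length of the roulette\<close>

lemma has_real_derivative_half_angle:
  fixes a b d t :: real
  assumes "0 < a" "0 < b" and d: "d\<^sup>2 = a\<^sup>2 - b\<^sup>2" and t: "t \<in> {-pi<..<pi}"
  shows "((\<lambda>t. 2 * a * arctan (sqrt ((a - d) / (a + d)) * tan (t / 2)))
    has_real_derivative a * b / (a + d * cos t)) (at t)"
proof -
  define k where "k = sqrt ((a - d) / (a + d))"
  have da: "a + d > 0" "a - d > 0"
    using abs_focus_less[OF assms(1-3)] by auto
  have k2: "k\<^sup>2 = (a - d) / (a + d)"
    using da by (simp add: k_def)
  \<comment> \<open>Rationalising the root through \<open>b\<^sup>2 = (a - d) * (a + d)\<close>
    brings \<open>b\<close> into the numerator of the derivative.\<close>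
  have "k = b / (a + d)"
  proof (rule power2_eq_imp_eq)
    have "b\<^sup>2 = (a - d) * (a + d)"
      using d by (simp add: algebra_simps power2_eq_square)
    then show "k\<^sup>2 = (b / (a + d))\<^sup>2"
      using da by (simp add: k2 power_divide) (simp add: power2_eq_square)
  qed (use da assms in \<open>auto simp: k_def\<close>)
  then have kd: "k * (a + d) = b"
    using da by simp
  define C S where "C = cos (t / 2)" and "S = sin (t / 2)"
  \<comment> \<open>Here \<open>t / 2\<close> stays strictly between the poles of the tangent at
    \<open>- pi / 2\<close> and \<open>pi / 2\<close>.\<close>
  have C: "C > 0"
    unfolding C_def using t by (intro cos_gt_zero_pi) auto
  have SC: "S\<^sup>2 = 1 - C\<^sup>2"
    by (simp add: S_def C_def sin_squared_eq)
  have ct: "cos t = 2 * C\<^sup>2 - 1"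
    using cos_double_cos[of "t / 2"] by (simp add: C_def)
  \<comment> \<open>The sum and the difference of \<open>C\<^sup>2\<close> and
    \<open>S\<^sup>2\<close> are 1 and \<open>cos t\<close>, which collects the terms in
    \<open>a\<close> and in \<open>d\<close>.\<close>
  have den: "(a + d) * (C\<^sup>2 + k\<^sup>2 * S\<^sup>2) = a + d * cos t"
  proof -
    have "(a + d) * (C\<^sup>2 + k\<^sup>2 * S\<^sup>2) = (a + d) * C\<^sup>2 + (a - d) * S\<^sup>2"
      using da by (simp add: k2 field_simps)
    then show ?thesis
      by (simp add: SC ct algebra_simps)
  qed
  have "((\<lambda>t. 2 * a * arctan (k * tan (t / 2))) has_real_derivative
      2 * a * (inverse (1 + (k * tan (t / 2))\<^sup>2) * (k * (inverse (C\<^sup>2) * (1 / 2))))) (at t)"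
    using C by (auto intro!: derivative_eq_intros simp: C_def)
  moreover have "2 * a * (inverse (1 + (k * tan (t / 2))\<^sup>2) * (k * (inverse (C\<^sup>2) * (1 / 2))))
      = a * k / (C\<^sup>2 + k\<^sup>2 * S\<^sup>2)"
  proof -
    have "tan (t / 2) = S / C"
      by (simp add: tan_def S_def C_def)
    then have "C\<^sup>2 * (1 + (k * tan (t / 2))\<^sup>2) = C\<^sup>2 + k\<^sup>2 * S\<^sup>2"
      using C by (simp add: power_mult_distrib power_divide distrib_left)
    \<comment> \<open>True for all \<open>X\<close> and \<open>Y\<close>: if one of them is 0, both
      sides are 0 by the convention for division by zero.\<close>
    moreover have "2 * a * (inverse X * (k * (inverse Y * (1 / 2)))) = a * k / (Y * X)" for X Y
      by (cases "X = 0"; cases "Y = 0") (simp_all add: field_simps)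
    ultimately show ?thesis
      by simp
  qed
  moreover have "a * k / (C\<^sup>2 + k\<^sup>2 * S\<^sup>2) = a * b / (a + d * cos t)"
    using da unfolding den[symmetric] kd[symmetric] by simp
  ultimately show ?thesis
    by (simp add: k_def)
qed

text \<open>The endpoints are kept apart from \<open>t0\<close>, which merely translates the
  roulette along the axis: lengths are needed both from \<open>t0\<close> and from
  \<open>- pi / 2\<close> to \<open>pi / 2\<close>.\<close>

lemma arc_length_roulette_ellipse_focus:
  fixes a b d x y :: real
  assumes "0 < a" "0 < b" and d: "d\<^sup>2 = a\<^sup>2 - b\<^sup>2"
    and xy: "x \<in> {-pi<..<pi}" "y \<in> {-pi<..<pi}"
  shows "arc_length (roulette (ellipse a b) (d, 0) t0) x y =
    2 * a * arctan (sqrt ((a - d) / (a + d)) * tan (y / 2))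
      - 2 * a * arctan (sqrt ((a - d) / (a + d)) * tan (x / 2))"
  unfolding arc_length_def speed_roulette_ellipse_focus[OF assms(1-3)]
proof (rule interval_integral_FTC_finite)
  have "\<bar>d\<bar> < a"
    using abs_focus_less assms by blast
  then have "a + d * cos z \<noteq> 0" for z
    using focal_radius_pos(1)[of d a z] by simp
  then show "continuous_on {min x y..max x y} (\<lambda>z. a * b / (a + d * cos z))"
    by (intro continuous_intros) auto
  fix z
  assume "min x y \<le> z" "z \<le> max x y"
  then have "z \<in> {-pi<..<pi}"
    using xy by (auto simp: min_def max_def split: if_splits)
  from has_real_derivative_half_angle[OF assms(1-3) this]
  show "((\<lambda>t. 2 * a * arctan (sqrt ((a - d) / (a + d)) * tan (t / 2)))
      has_vector_derivative a * b / (a + d * cos z)) (at z within {min x y..max x y})"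
    by (simp add: has_real_derivative_iff_has_vector_derivative
        has_vector_derivative_at_within)
qed

theorem mainTheorem1:
  fixes a b c t0 :: real and B1 B2 :: "real \<Rightarrow> real \<times> real"
  assumes "0 < b" and "b < a"
    and "c = sqrt (a\<^sup>2 - b\<^sup>2)"
    and "B1 = roulette (ellipse a b) (c, 0) t0"
    and "B2 = roulette (ellipse a b) (- c, 0) t0"
  shows
    "((\<forall>t. B1 t =
        ((LBINT z=ereal t0..ereal t. sqrt (a\<^sup>2 - c\<^sup>2 * (cos z)\<^sup>2))
           - c * sin t * (a - c * cos t) / sqrt (a\<^sup>2 - c\<^sup>2 * (cos t)\<^sup>2),
         b * (a - c * cos t) / sqrt (a\<^sup>2 - c\<^sup>2 * (cos t)\<^sup>2)))
      \<and> (\<forall>t. B1 differentiable at t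
            \<and> norm (vector_derivative B1 (at t)) = a * b / (a + c * cos t))
      \<and> (t0 \<in> {-pi<..<pi} \<longrightarrow> (\<forall>t\<in>{-pi<..<pi}.
           (LBINT z=ereal t0..ereal t. norm (vector_derivative B1 (at z)))
             = 2 * a * arctan (sqrt ((a - c) / (a + c)) * tan (t / 2))
               - 2 * a * arctan (sqrt ((a - c) / (a + c)) * tan (t0 / 2)))))
     \<and>
     ((\<forall>t. B2 t =
        ((LBINT z=ereal t0..ereal t. sqrt (a\<^sup>2 - c\<^sup>2 * (cos z)\<^sup>2))
           + c * sin t * (a + c * cos t) / sqrt (a\<^sup>2 - c\<^sup>2 * (cos t)\<^sup>2),
         b * (a + c * cos t) / sqrt (a\<^sup>2 - c\<^sup>2 * (cos t)\<^sup>2)))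
      \<and> (\<forall>t. B2 differentiable at t
            \<and> norm (vector_derivative B2 (at t)) = a * b / (a - c * cos t))
      \<and> (t0 \<in> {-pi<..<pi} \<longrightarrow> (\<forall>t\<in>{-pi<..<pi}.
           (LBINT z=ereal t0..ereal t. norm (vector_derivative B2 (at z)))
             = 2 * a * arctan (sqrt ((a + c) / (a - c)) * tan (t / 2))
               - 2 * a * arctan (sqrt ((a + c) / (a - c)) * tan (t0 / 2)))))
     \<and>
     arc_length B1 (- pi / 2) (pi / 2) + arc_length B2 (- pi / 2) (pi / 2) = 2 * pi * a"
proof -
  have a: "0 < a"
    using assms by simp
  have c2: "c\<^sup>2 = a\<^sup>2 - b\<^sup>2"
    using assms by (simp add: power_mono)
  then have c2': "(- c)\<^sup>2 = a\<^sup>2 - b\<^sup>2"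
    by simp
  note ab = a \<open>0 < b\<close>
  have diff: "roulette (ellipse a b) (d, 0) t0 differentiable at t" if "d\<^sup>2 = a\<^sup>2 - b\<^sup>2" for d t
    using has_vector_derivative_roulette_ellipse_focus[OF ab that] by (rule differentiableI_vector)
  have half: "- pi / 2 \<in> {-pi<..<pi}" "pi / 2 \<in> {-pi<..<pi}"
    using pi_gt_zero unfolding greaterThanLessThan_iff by linarith+
  have sum: "arc_length B1 (- pi / 2) (pi / 2) + arc_length B2 (- pi / 2) (pi / 2) = 2 * pi * a"
  proof -
    define k where "k = sqrt ((a - c) / (a + c))"
    have k: "k > 0"
      using abs_focus_less[OF ab c2] by (simp add: k_def)
    \<comment> \<open>Exchanging the foci replaces \<open>c\<close> by \<open>- c\<close> and so
      inverts the constant.\<close>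
    have ik: "sqrt ((a + c) / (a - c)) = 1 / k"
      by (simp add: k_def real_sqrt_divide)
    have tan: "tan (pi / 2 / 2) = 1" "tan (- pi / 2 / 2) = - 1"
      using tan_45 by simp_all
    have "arc_length B1 (- pi / 2) (pi / 2) = 4 * a * arctan k"
      unfolding assms(4) arc_length_roulette_ellipse_focus[OF ab c2 half] tan
      by (simp add: arctan_minus flip: k_def)
    moreover have "arc_length B2 (- pi / 2) (pi / 2) = 4 * a * arctan (1 / k)"
      unfolding assms(5) arc_length_roulette_ellipse_focus[OF ab c2' half] tan
      by (simp add: arctan_minus ik)
    \<comment> \<open>For positive \<open>k\<close> the two angles are complementary, so the lengths
      add up to \<open>4 * a * (pi / 2)\<close>.\<close>
    moreover have "arctan (1 / k) = pi / 2 - arctan k"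
      using k arctan_inverse[of k] by (simp add: inverse_eq_divide)
    ultimately show ?thesis
      by (simp add: algebra_simps)
  qed
  show ?thesis
    using roulette_ellipse_focus[OF ab c2, of t0] roulette_ellipse_focus[OF ab c2', of t0]
      speed_roulette_ellipse_focus[OF ab c2, of t0] speed_roulette_ellipse_focus[OF ab c2', of t0]
      arc_length_roulette_ellipse_focus[OF ab c2, of t0 _ t0]
      arc_length_roulette_ellipse_focus[OF ab c2', of t0 _ t0]
      diff[OF c2] diff[OF c2'] sum
    by (simp add: assms(4,5) speed_def arc_length_def)
qed

end
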